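(* Let $\Theta \subseteq \mathbb{R}^P$ be a subset with non-empty interior, let $\mathcal{H}$ be a function space, and let $\mathcal{A} \colon \mathcal{H} \to \mathbb{R}^M$ be a (possibly non-linear) operator, where $\mathcal{H}$ is equipped with the coarsest topology $\eta$ making $\mathcal{A}$ continuous with respect to the Euclidean topology of $\mathbb{R}^M$. Let $\Phi \colon \Theta \to \mathcal{H}$ be continuous from $(\Theta, \varepsilon_\Theta)$ to $(\mathcal{H}, \eta)$, where $\varepsilon_\Theta$ is the subspace topology induced by the Euclidean topology of $\mathbb{R}^P$. Assume that $\mathcal{A} \circ \Phi$ is injective. Let $\mathcal{M} := (\mathcal{A} \circ \Phi)(\Theta)$ be equipped with the topology $\varepsilon_{\mathcal{M}}$ inherited as a subspace of $\mathbb{R}^M$, and let $$\tau := \left\{ (\mathcal{A} \circ \Phi)^{-1}(\mathcal{U}) : \mathcal{U} \in \varepsilon_{\mathcal{M}} \right\}.$$ Then $\mathcal{A} \circ \Phi$ is a homeomorphism between the topological spaces $(\Theta, \tau)$ and $(\mathcal{M}, \varepsilon_{\mathcal{M}})$.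
   Context: $P$ and $M$ are positive integers. In the definition of $\tau$, $(\mathcal{A} \circ \Phi)^{-1}(\mathcal{U})$ denotes the preimage of $\mathcal{U}$; thus $\tau$ is the coarsest topology on $\Theta$ making $\mathcal{A} \circ \Phi \colon \Theta \to (\mathcal{M}, \varepsilon_{\mathcal{M}})$ continuous. The function $\mathcal{A} \circ \Phi$ is regarded as a map onto its image $\mathcal{M}$. The space $\mathcal{H}$ is used only as a set of functions equipped with the topology $\eta$. *)

theory Defs
  imports "HOL-Analysis.Analysis"
begin

definition coarsest_topology_for :: "'a set \<Rightarrow> ('a \<Rightarrow> 'b) \<Rightarrow> 'b topology \<Rightarrow> 'a topology \<Rightarrow> bool" where
  "coarsest_topology_for S f Y X \<longleftrightarrow>
     topspace X = S \<and> continuous_map X Y f \<and>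
     (\<forall>X'. topspace X' = S \<and> continuous_map X' Y f \<longrightarrow> (\<forall>U. openin X U \<longrightarrow> openin X' U))"

text \<open>Such a topology exists and is unique as soon as \<open>f\<close> maps \<open>S\<close> into the space \<open>Y\<close>.\<close>

lemma coarsest_topology_for_iff_pullback:
  assumes "f ` S \<subseteq> topspace Y"
  shows "coarsest_topology_for S f Y X \<longleftrightarrow> X = pullback_topology S f Y"
proof -
  let ?P = "pullback_topology S f Y"
  have top: "topspace ?P = S"
    using assms by (auto simp: topspace_pullback_topology)
  have cont: "continuous_map ?P Y f"
    using continuous_map_pullback[OF continuous_map_id, of S f Y] by simp
  have least: "openin X' U"
    if h: "topspace X' = S" "continuous_map X' Y f" "openin ?P U" for X' U
  proof -
    obtain V where V: "openin Y V" "U = f -` V \<inter> S"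
      using h(3) by (auto simp: openin_pullback_topology)
    then have "U = {x \<in> topspace X'. f x \<in> V}"
      using h(1) by auto
    then show ?thesis
      using openin_continuous_map_preimage[OF h(2) V(1)] by simp
  qed
  show ?thesis
  proof
    assume "coarsest_topology_for S f Y X"
    then have "\<forall>U. openin X U \<longleftrightarrow> openin ?P U"
      unfolding coarsest_topology_for_def using top cont least by blast
    then show "X = ?P"
      by (simp add: topology_eq)
  next
    assume "X = ?P"
    then show "coarsest_topology_for S f Y X"
      unfolding coarsest_topology_for_def using top cont least by blast
  qed
qed

end

theory Submission
  imports Defs
begin

text \<open>A bijection becomes a homeomorphism once its domain carries the topology pulled back
  from its codomain. The open sets upstairs are exactly the preimages of open sets, so continuity is
  built in; by surjectivity the image of such a preimage is the original open set, so the map is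
  open. A continuous open bijection is a homeomorphism.
  \<open>homeomorphic_map_pullback_topology\<close> proves this for any target space.\<close>

lemma homeomorphic_map_pullback_topology:
  assumes "inj_on f S" and "f ` S = topspace Y"
  shows "homeomorphic_map (pullback_topology S f Y) Y f"
proof (rule bijective_open_imp_homeomorphic_map)
  have top: "topspace (pullback_topology S f Y) = S"
    using assms(2) by (auto simp: topspace_pullback_topology)
  show "continuous_map (pullback_topology S f Y) Y f"
    using continuous_map_pullback[OF continuous_map_id, of S f Y] by simp
  show "open_map (pullback_topology S f Y) Y f"
    unfolding open_map_def
  proof (intro allI impI)
    fix U assume "openin (pullback_topology S f Y) U"
    then obtain V where V: "openin Y V" "U = f -` V \<inter> S"
      by (auto simp: openin_pullback_topology)
    \<comment> \<open>Every point of V is hit from S, since V lies in \<open>topspace Y\<close>,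
      which is the image of S.\<close>
    have "f ` U = V"
      using openin_subset[OF V(1)] by (auto simp: V(2) assms(2)[symmetric])
    with V(1) show "openin Y (f ` U)"
      by simp
  qed
  show "f ` topspace (pullback_topology S f Y) = topspace Y"
    by (simp add: top assms(2))
  show "inj_on f (topspace (pullback_topology S f Y))"
    by (simp add: top assms(1))
qed

theorem lemma2p1:
  fixes \<Theta> :: "(real ^ 'p) set"
    and \<H> :: "('x \<Rightarrow> 'y) set"
    and \<A> :: "('x \<Rightarrow> 'y) \<Rightarrow> real ^ 'm"
    and \<eta> :: "('x \<Rightarrow> 'y) topology"
    and \<Phi> :: "real ^ 'p \<Rightarrow> ('x \<Rightarrow> 'y)"
    and \<M> :: "(real ^ 'm) set"
    and \<tau> :: "(real ^ 'p) topology"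
  assumes "interior \<Theta> \<noteq> {}"
    and "coarsest_topology_for \<H> \<A> euclidean \<eta>"
    and "continuous_map (top_of_set \<Theta>) \<eta> \<Phi>"
    and "inj_on (\<A> \<circ> \<Phi>) \<Theta>"
    and "\<M> = (\<A> \<circ> \<Phi>) ` \<Theta>"
    and "\<tau> = pullback_topology \<Theta> (\<A> \<circ> \<Phi>) (top_of_set \<M>)"
  shows "homeomorphic_map \<tau> (top_of_set \<M>) (\<A> \<circ> \<Phi>)"
  unfolding assms(6)
  \<comment> \<open>Surjectivity is automatic: the target \<M> is by definition the image of
    \<Theta>.\<close>
  by (rule homeomorphic_map_pullback_topology[OF assms(4)]) (simp add: assms(5))

end
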